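(* For every rollout $\tau$ with $T$ actions of token lengths $L_1,\dots,L_T$, total length $L=\sum_{i=1}^T L_i$, influence-dependency data and trajectory advantage $\hat A_\tau$ as defined in the context, the routed token advantages $A_{i,\ell}$ satisfy $$\sum_{i=1}^{T}\sum_{\ell\in a_i} A_{i,\ell}=L\,\hat A_\tau ,$$ where the inner sum runs over the $L_i$ tokens $\ell$ of action $a_i$.
   Context: Rollout. A rollout $\tau$ consists of $T\ge 1$ actions $a_1,\dots,a_T$; action $a_i$ has $L_i\ge 1$ tokens, and $L=\sum_{i=1}^T L_i$. Its trajectory advantage is the real number $\hat A_\tau=(R_\tau-\mu_{\mathcal G})/(\sigma_{\mathcal G}+\varepsilon)$, where $R_\tau\in\mathbb R$ is the terminal reward of $\tau$, and $\mu_{\mathcal G},\sigma_{\mathcal G}$ are the mean and standard deviation of the terminal rewards over a finite group $\mathcal G$ of $K$ rollouts containing $\tau$. Throughout $\varepsilon=10^{-6}$. Influence-dependency data. Edge sets $E^{+},E^{-}\subseteq\{(i,j):1\le i<j\le T\}$ (support-use and failed-use edges), error indicators $e_i\in\{0,1\}$, and direct-input counts $u_i^{\mathrm{dir}}\in\mathbb Z_{\ge 0}$ for $1\le i\le T$. Put $d_i^{+}=|\{j:(i,j)\in E^{+}\}|$, $d_i^{-}=|\{j:(i,j)\in E^{-}\}|$, $d_i^{\mathrm{in}}=u_i^{\mathrm{dir}}+|\{k:(k,i)\in E^{+}\}|$. It is assumed that $d_i^{-}>0$ implies $e_i=1$. Graph features. $\phi_i^{+}=\log(1+d_i^{+}+d_i^{\mathrm{in}})$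 and $\phi_i^{-}=\log\bigl(1+e_i(1+d_i^{-}+d_i^{\mathrm{in}})\bigr)$. Normalization. Fix a clipping constant $c>0$, with $\mathrm{clip}(z,-c,c)=\max(-c,\min(z,c))$. For $\phi\in\mathbb R_{\ge 0}^T$ let $\bar\phi=\frac1L\sum_i L_i\phi_i$, $\sigma_\phi^2=\frac1L\sum_i L_i(\phi_i-\bar\phi)^2$ (with $\sigma_\phi\ge 0$), $z_i=(\phi_i-\bar\phi)/(\sigma_\phi+\varepsilon)$, and $$m_i=\frac{\exp(\mathrm{clip}(z_i,-c,c))}{\frac1L\sum_j L_j\exp(\mathrm{clip}(z_j,-c,c))}.$$ Write $m_i^{+}$ and $m_i^{-}$ for the values obtained from $\phi=\phi^{+}$ and $\phi=\phi^{-}$ respectively. Routing weights. Fix $\beta_{+}\ge 0$ and let $\psi_i^{-}=\phi_i^{-}-\bar\phi^{-}$ with $\bar\phi^{-}=\frac1L\sum_i L_i\phi_i^{-}$. Define $$w_i^{+}=\frac{L\,m_i^{+}\exp(-\beta_{+}\psi_i^{-})}{\sum_j L_j\,m_j^{+}\exp(-\beta_{+}\psi_j^{-})},\qquad w_i^{-}=m_i^{-}.$$ Routed advantage. Every token $\ell$ of action $a_i$ receives $A_{i,\ell}=\hat A_\tau\,w_i$, where $w_i=w_i^{+}$ if $\hat A_\tau>0$ and $w_i=w_i^{-}$ if $\hat A_\tau<0$; if $\hat A_\tau=0$ then $A_{i,\ell}=0$. *)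

theory Defs
  imports Complex_Main
begin

definition eps :: real where
  "eps = 1 / 10 ^ 6"

text \<open>Actions are numbered from 1 to \<open>num_actions\<close>; the fields of function type are only
  meaningful on that range.\<close>

record rollout =
  num_actions :: nat
  num_tokens :: "nat \<Rightarrow> nat"
  terminal_reward :: real
  support_edges :: "(nat \<times> nat) set"
  failed_edges :: "(nat \<times> nat) set"
  error_ind :: "nat \<Rightarrow> nat"
  direct_inputs :: "nat \<Rightarrow> nat"

definition deg_support :: "rollout \<Rightarrow> nat \<Rightarrow> nat" where
  "deg_support \<tau> i = card {j. (i, j) \<in> support_edges \<tau>}"

definition deg_failed :: "rollout \<Rightarrow> nat \<Rightarrow> nat" where
  "deg_failed \<tau> i = card {j. (i, j) \<in> failed_edges \<tau>}"

definition deg_in :: "rollout \<Rightarrow> nat \<Rightarrow> nat" where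
  "deg_in \<tau> i = direct_inputs \<tau> i + card {k. (k, i) \<in> support_edges \<tau>}"

definition valid_rollout :: "rollout \<Rightarrow> bool" where
  "valid_rollout \<tau> \<longleftrightarrow>
     num_actions \<tau> \<ge> 1 \<and>
     (\<forall>i \<in> {1..num_actions \<tau>}. num_tokens \<tau> i \<ge> 1) \<and>
     support_edges \<tau> \<subseteq> {(i, j). 1 \<le> i \<and> i < j \<and> j \<le> num_actions \<tau>} \<and>
     failed_edges \<tau> \<subseteq> {(i, j). 1 \<le> i \<and> i < j \<and> j \<le> num_actions \<tau>} \<and>
     (\<forall>i \<in> {1..num_actions \<tau>}. error_ind \<tau> i \<in> {0, 1}) \<and>
     (\<forall>i \<in> {1..num_actions \<tau>}. deg_failed \<tau> i > 0 \<longrightarrow> error_ind \<tau> i = 1)"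

definition total_tokens :: "rollout \<Rightarrow> nat" where
  "total_tokens \<tau> = (\<Sum>i = 1..num_actions \<tau>. num_tokens \<tau> i)"

text \<open>A group of \<open>K\<close> rollouts is a family \<open>\<G>\<close> indexed by \<open>{1..K}\<close>, so that the same rollout may
  occur several times. The standard deviation is the population one (divisor \<open>K\<close>).\<close>

definition group_mean :: "nat \<Rightarrow> (nat \<Rightarrow> rollout) \<Rightarrow> real" where
  "group_mean K \<G> = (\<Sum>k = 1..K. terminal_reward (\<G> k)) / real K"

definition group_sd :: "nat \<Rightarrow> (nat \<Rightarrow> rollout) \<Rightarrow> real" where
  "group_sd K \<G> =
     sqrt ((\<Sum>k = 1..K. (terminal_reward (\<G> k) - group_mean K \<G>)\<^sup>2) / real K)"

definition trajectory_advantage :: "nat \<Rightarrow> (nat \<Rightarrow> rollout) \<Rightarrow> rollout \<Rightarrow> real" where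
  "trajectory_advantage K \<G> \<tau> =
     (terminal_reward \<tau> - group_mean K \<G>) / (group_sd K \<G> + eps)"

definition phi_pos :: "rollout \<Rightarrow> nat \<Rightarrow> real" where
  "phi_pos \<tau> i = ln (1 + real (deg_support \<tau> i) + real (deg_in \<tau> i))"

definition phi_neg :: "rollout \<Rightarrow> nat \<Rightarrow> real" where
  "phi_neg \<tau> i =
     ln (1 + real (error_ind \<tau> i) * (1 + real (deg_failed \<tau> i) + real (deg_in \<tau> i)))"

definition token_mean :: "rollout \<Rightarrow> (nat \<Rightarrow> real) \<Rightarrow> real" where
  "token_mean \<tau> f =
     1 / real (total_tokens \<tau>) * (\<Sum>i = 1..num_actions \<tau>. real (num_tokens \<tau> i) * f i)"

definition token_sd :: "rollout \<Rightarrow> (nat \<Rightarrow> real) \<Rightarrow> real" where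
  "token_sd \<tau> \<phi> = sqrt (token_mean \<tau> (\<lambda>i. (\<phi> i - token_mean \<tau> \<phi>)\<^sup>2))"

definition z_score :: "rollout \<Rightarrow> (nat \<Rightarrow> real) \<Rightarrow> nat \<Rightarrow> real" where
  "z_score \<tau> \<phi> i = (\<phi> i - token_mean \<tau> \<phi>) / (token_sd \<tau> \<phi> + eps)"

definition clip :: "real \<Rightarrow> real \<Rightarrow> real \<Rightarrow> real" where
  "clip z lo hi = max lo (min z hi)"

definition multiplier :: "real \<Rightarrow> rollout \<Rightarrow> (nat \<Rightarrow> real) \<Rightarrow> nat \<Rightarrow> real" where
  "multiplier c \<tau> \<phi> i =
     exp (clip (z_score \<tau> \<phi> i) (- c) c) /
     token_mean \<tau> (\<lambda>j. exp (clip (z_score \<tau> \<phi> j) (- c) c))"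

definition psi_neg :: "rollout \<Rightarrow> nat \<Rightarrow> real" where
  "psi_neg \<tau> i = phi_neg \<tau> i - token_mean \<tau> (phi_neg \<tau>)"

definition weight_pos :: "real \<Rightarrow> real \<Rightarrow> rollout \<Rightarrow> nat \<Rightarrow> real" where
  "weight_pos c \<beta> \<tau> i =
     real (total_tokens \<tau>) * multiplier c \<tau> (phi_pos \<tau>) i * exp (- \<beta> * psi_neg \<tau> i) /
     (\<Sum>j = 1..num_actions \<tau>.
        real (num_tokens \<tau> j) * multiplier c \<tau> (phi_pos \<tau>) j * exp (- \<beta> * psi_neg \<tau> j))"

definition weight_neg :: "real \<Rightarrow> rollout \<Rightarrow> nat \<Rightarrow> real" where
  "weight_neg c \<tau> i = multiplier c \<tau> (phi_neg \<tau>) i"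

text \<open>The advantage of token \<open>l\<close> of action \<open>i\<close>; all tokens of an action receive the same value.\<close>

definition routed_advantage ::
    "real \<Rightarrow> real \<Rightarrow> nat \<Rightarrow> (nat \<Rightarrow> rollout) \<Rightarrow> rollout \<Rightarrow> nat \<Rightarrow> nat \<Rightarrow> real" where
  "routed_advantage c \<beta> K \<G> \<tau> i l =
     (let A = trajectory_advantage K \<G> \<tau> in
      if A > 0 then A * weight_pos c \<beta> \<tau> i
      else if A < 0 then A * weight_neg c \<tau> i
      else 0)"

end

theory Submission
  imports Defs
begin

text \<open>Routing only redistributes the advantage. On either sign branch the weight of an action
  is a positive quantity divided by its own token-weighted sum (or mean), so the token-weighted sum
  of the weights is \<open>total_tokens \<tau>\<close>: this is \<open>sum_tokens_multiplier\<close>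
  for the negative branch and \<open>sum_tokens_weight_pos\<close> for the positive one. All tokens
  of an action share one value, so the double sum is the trajectory advantage times that weighted
  sum. What must be checked is that no normalizing sum vanishes, which \<open>token_sum_pos\<close>
  provides.\<close>

text \<open>A valid rollout has at least one action and every action at least one token, so the sum
  is nonempty with positive terms.\<close>

lemma token_sum_pos:
  assumes "valid_rollout \<tau>" and "\<And>i. i \<in> {1..num_actions \<tau>} \<Longrightarrow> f i > 0"
  shows "(\<Sum>i = 1..num_actions \<tau>. real (num_tokens \<tau> i) * f i) > 0"
  using assms by (intro sum_pos) (auto simp: valid_rollout_def Suc_le_eq)

lemma total_tokens_pos:
  assumes "valid_rollout \<tau>"
  shows "total_tokens \<tau> > 0"
  using token_sum_pos[OF assms, of "\<lambda>_. 1"]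
  by (simp add: total_tokens_def flip: of_nat_sum)

lemma token_mean_pos:
  assumes "valid_rollout \<tau>" and "\<And>i. i \<in> {1..num_actions \<tau>} \<Longrightarrow> f i > 0"
  shows "token_mean \<tau> f > 0"
  using token_sum_pos[OF assms] total_tokens_pos[OF assms(1)] by (simp add: token_mean_def)

text \<open>A quotient of an exponential by a token mean of exponentials; it makes the normalizer of
  \<open>weight_pos\<close> positive.\<close>

lemma multiplier_pos:
  assumes "valid_rollout \<tau>"
  shows "multiplier c \<tau> \<phi> i > 0"
  by (simp add: multiplier_def token_mean_pos[OF assms])

lemma sum_tokens_multiplier:
  assumes "valid_rollout \<tau>"
  shows "(\<Sum>i = 1..num_actions \<tau>. real (num_tokens \<tau> i) * multiplier c \<tau> \<phi> i)
           = real (total_tokens \<tau>)"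
proof -
  define g where "g i = exp (clip (z_score \<tau> \<phi> i) (- c) c)" for i
  \<comment> \<open>This sum is the normalizer up to the factor
    \<open>1 / real (total_tokens \<tau>)\<close>; being nonzero, it cancels against the
    numerators.\<close>
  have "(\<Sum>i = 1..num_actions \<tau>. real (num_tokens \<tau> i) * g i) > 0"
    using assms by (rule token_sum_pos) (simp add: g_def)
  then show ?thesis
    by (simp add: multiplier_def token_mean_def
        flip: g_def sum_divide_distrib sum_distrib_left sum_distrib_right mult.assoc)
qed

lemma sum_tokens_weight_pos:
  assumes "valid_rollout \<tau>"
  shows "(\<Sum>i = 1..num_actions \<tau>. real (num_tokens \<tau> i) * weight_pos c \<beta> \<tau> i)
           = real (total_tokens \<tau>)"
proof -
  define g where "g i = multiplier c \<tau> (phi_pos \<tau>) i * exp (- \<beta> * psi_neg \<tau> i)" for i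
  define S where "S = (\<Sum>i = 1..num_actions \<tau>. real (num_tokens \<tau> i) * g i)"
  have "S > 0"
    unfolding S_def using assms by (rule token_sum_pos) (simp add: g_def multiplier_pos[OF assms])
  \<comment> \<open>The factor in front of \<open>g i\<close> does not depend on \<open>i\<close>,
    so it leaves the sum, and what remains is \<open>S\<close> itself.\<close>
  have "weight_pos c \<beta> \<tau> i = real (total_tokens \<tau>) / S * g i" for i
    by (simp add: weight_pos_def S_def g_def mult.assoc)
  then have "(\<Sum>i = 1..num_actions \<tau>. real (num_tokens \<tau> i) * weight_pos c \<beta> \<tau> i)
               = real (total_tokens \<tau>) / S * S"
    by (simp add: S_def sum_distrib_left sum_divide_distrib mult_ac)
  with \<open>S > 0\<close> show ?thesis
    by simp
qed

theorem proposition1: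
  fixes K :: nat and \<G> :: "nat \<Rightarrow> rollout" and \<tau> :: rollout and c \<beta> :: real
  assumes "\<And>k. k \<in> {1..K} \<Longrightarrow> valid_rollout (\<G> k)"
    and "\<tau> \<in> \<G> ` {1..K}"
    and "c > 0"
    and "\<beta> \<ge> 0"
  shows "(\<Sum>i = 1..num_actions \<tau>. \<Sum>l = 1..num_tokens \<tau> i. routed_advantage c \<beta> K \<G> \<tau> i l)
           = real (total_tokens \<tau>) * trajectory_advantage K \<G> \<tau>"
proof -
  define A where "A = trajectory_advantage K \<G> \<tau>"
  \<comment> \<open>For \<open>A = 0\<close> the choice of weight is immaterial:
    \<open>A * w i\<close> is 0, as in the third branch of \<open>routed_advantage\<close>.\<close>
  define w where "w = (if A > 0 then weight_pos c \<beta> \<tau> else weight_neg c \<tau>)"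
  from assms(1,2) have valid: "valid_rollout \<tau>"
    by auto
  have routed: "routed_advantage c \<beta> K \<G> \<tau> i l = A * w i" for i l
    by (simp add: routed_advantage_def w_def flip: A_def)
  have "(\<Sum>i = 1..num_actions \<tau>. real (num_tokens \<tau> i) * w i) = real (total_tokens \<tau>)"
    using sum_tokens_weight_pos[OF valid] sum_tokens_multiplier[OF valid]
    by (simp add: w_def weight_neg_def)
  then show ?thesis
    by (simp add: routed mult.left_commute flip: A_def sum_distrib_left)
qed

end
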